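(* Let $(\boldsymbol{\alpha},\mathbf{T},\mathbf{U},\mathbf{Q}_1,\mathbf{Q}_2)$ be the parameters of a common-shock phase-type model, and let $$g(x_{1,2},x_1,x_2)=\boldsymbol{\alpha}e^{\mathbf{T}x_{1,2}}\mathbf{P}\Bigl((e^{\mathbf{Q}_1x_1}\mathbf{q}_1)\otimes(e^{\mathbf{Q}_2x_2}\mathbf{q}_2)\Bigr),\qquad x_{1,2},x_1,x_2\ge0,$$ be the joint density of $(\tau_{1,2},\tilde\tau_1,\tilde\tau_2)$, where $\mathbf{q}_i=-\mathbf{Q}_i\mathbf{1}$ and $\mathbf{P}=\sum_{k\in\mathcal{S}}\mathbf{U}\mathbf{e}_k(\mathbf{e}_k^\top\otimes\mathbf{e}_k^\top)$. For $n_{1,2},n_1,n_2\in\mathbb{N}_0=\{0,1,2,\dots\}$ and real parameters $\theta_{1,2},\theta_1,\theta_2$, the numerator of the size-biased Esscher transformed probability density function is given, for $x_{1,2},x_1,x_2\ge0$, by \begin{align*} &x_{1,2}^{n_{1,2}}x_1^{n_1}x_2^{n_2}e^{-\theta_{1,2}x_{1,2}-\theta_1x_1-\theta_2x_2}\,g(x_{1,2},x_1,x_2)\\ &\quad=(n_{1,2}!\,n_1!\,n_2!)\,\boldsymbol{\alpha}^{(n_{1,2})}e^{\mathbf{T}^{(n_{1,2},\theta_{1,2})}x_{1,2}}\mathbf{I}^{(\downarrow,n_{1,2})}\mathbf{P}\\ &\qquad\times\Bigl[\bigl(\mathbf{I}^{(\leftarrow,n_1)}e^{\mathbf{Q}_1^{(n_1,\theta_1)}x_1}\mathbf{q}_1^{(n_1)}\bigr)\otimes\bigl(\mathbf{I}^{(\leftarrow,n_2)}e^{\mathbf{Q}_2^{(n_2,\theta_2)}x_2}\mathbf{q}_2^{(n_2)}\bigr)\Bigr],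 \end{align*} where $\times$ denotes the ordinary matrix product and the augmented objects $\boldsymbol{\alpha}^{(N)}$, $\mathbf{M}^{(N,\theta)}$ (for $\mathbf{M}=\mathbf{T},\mathbf{Q}_1,\mathbf{Q}_2$), $\mathbf{q}_i^{(N)}$, $\mathbf{I}^{(\downarrow,N)}$, $\mathbf{I}^{(\leftarrow,N)}$ are the block vectors and matrices, with $N+1$ blocks, defined in the context.
   Context: Model. $\mathcal{E}$ (pre-shock states) and $\mathcal{S}$ (post-shock states) are disjoint finite nonempty sets; $\boldsymbol{\alpha}$ is a row probability vector on $\mathcal{E}$; $\mathbf{T}$ is a subintensity matrix on $\mathcal{E}$ and $\mathbf{Q}_1,\mathbf{Q}_2$ are subintensity matrices on $\mathcal{S}$ (nonpositive diagonal entries, nonnegative off-diagonal entries, nonpositive row sums), all of whose states are transient (equivalently, the matrices are nonsingular); $\mathbf{U}$ is an entrywise nonnegative $|\mathcal{E}|\times|\mathcal{S}|$ matrix with $\mathbf{T}\mathbf{1}+\mathbf{U}\mathbf{1}=\mathbf{0}$. A Markov jump process starts in $\mathcal{E}$ according to $\boldsymbol{\alpha}$, moves in $\mathcal{E}$ with rates $\mathbf{T}$ and jumps to $\mathcal{S}$ with rates $\mathbf{U}$; $\tau_{1,2}$ is its exit time from $\mathcal{E}$ and $K$ the state of $\mathcal{S}$ entered then. Given $K$, two processes start from $K$ and evolve on $\mathcal{S}$ independently of each other and of $\tau_{1,2}$, with subintensity matrices $\mathbf{Q}_1,\mathbf{Q}_2$, until absorption outside $\mathcal{E}\cup\mathcal{S}$;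 $\tilde\tau_1,\tilde\tau_2$ are their absorption times, measured from the shock. The size-biased Esscher transformed density of $(\tau_{1,2},\tilde\tau_1,\tilde\tau_2)$ is $$\frac{x_{1,2}^{n_{1,2}}x_1^{n_1}x_2^{n_2}e^{-\theta_{1,2}x_{1,2}-\theta_1x_1-\theta_2x_2}g(x_{1,2},x_1,x_2)}{\mathbb{E}\bigl[\tau_{1,2}^{n_{1,2}}\tilde\tau_1^{n_1}\tilde\tau_2^{n_2}e^{-\theta_{1,2}\tau_{1,2}-\theta_1\tilde\tau_1-\theta_2\tilde\tau_2}\bigr]}$$ (only its numerator appears in the claim; $0^0=1$). Augmented objects. For $N\in\mathbb{N}_0$, $\theta\in\mathbb{R}$ and a $p\times p$ matrix $\mathbf{M}$: $\boldsymbol{\alpha}^{(N)}=(\boldsymbol{\alpha},\mathbf{0},\dots,\mathbf{0})$ is a row vector with $N+1$ blocks of length $|\mathcal{E}|$; $\mathbf{M}^{(N,\theta)}$ is the $(N+1)p\times(N+1)p$ block upper bidiagonal matrix with $N+1$ diagonal blocks $\mathbf{M}-\theta\mathbf{I}$, all blocks on the first superdiagonal equal to $\mathbf{I}$ (the $p\times p$ identity), and all other blocks zero; $\mathbf{q}_i^{(N)}$ is the column vector with $N+1$ blocks of length $|\mathcal{S}|$, the last block being $\mathbf{q}_i$ and the others zero; $\mathbf{I}^{(\downarrow,N)}$ is the $(N+1)p\times p$ matrix whose last $p\times p$ block is $\mathbf{I}$ and whose other blocks are zero (here $p=|\mathcal{E}|$); $\mathbf{I}^{(\leftarrow,N)}=(\mathbf{I},\mathbf{0},\dots,\mathbf{0})$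 is the $p\times(N+1)p$ matrix whose first $p\times p$ block is $\mathbf{I}$ and whose other blocks are zero (here $p=|\mathcal{S}|$). Notation: $\mathbf{1}$ is a column vector of ones, $\mathbf{e}_k$ the $k$-th standard basis column vector of $\mathbb{R}^{\mathcal{S}}$, $\otimes$ the Kronecker product. *)

theory Defs
  imports "Jordan_Normal_Form.Jordan_Normal_Form" Complex_Main
begin

(* Matrices over finite state spaces are the matrices of the Jordan_Normal_Form library: the
   states are numbered 0, 1, ..., and row (column) vectors are matrices with one row (column).
   Scalars such as the density below are the single entry of a 1 x 1 product. *)

section \<open>Matrix exponential, block matrices, Kronecker product\<close>

text \<open>The exponential of a square matrix is the entrywise sum of the series of
  \<open>A ^ k / k!\<close>; the series converges by the lemma \<open>summable_mat_exp\<close>.\<close>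

definition mat_exp :: "real mat \<Rightarrow> real mat" where
  "mat_exp A = mat (dim_row A) (dim_col A) (\<lambda>(i, j). \<Sum>k. (A ^\<^sub>m k) $$ (i, j) / fact k)"

lemma summable_mat_exp:
  fixes A :: "real mat"
  assumes A: "A \<in> carrier_mat n n" and ij: "i < n" "j < n"
  shows "summable (\<lambda>k. (A ^\<^sub>m k) $$ (i, j) / fact k)"
proof -
  define b where "b = Max {norm (A $$ (i,j)) | i j. i < dim_row A \<and> j < dim_col A}"
  have b: "norm_bound A b"
    unfolding b_def by (rule norm_bound_max)
  have bound: "norm_bound (A ^\<^sub>m k) ((b * real n) ^ k)" for k
  proof (induction k)
    case 0
    show ?case using A by (auto simp: norm_bound_def)
  next
    case (Suc k)
    have "norm_bound (A ^\<^sub>m k * A) ((b * real n) ^ k * b * of_nat n)"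
      using A by (intro norm_bound_mult[OF _ A Suc b]) auto
    then show ?case by (simp add: mult_ac)
  qed
  show ?thesis
  proof (rule summable_comparison_test[OF _ summable_exp[of "b * real n"]], intro exI allI impI)
    fix k
    have "norm ((A ^\<^sub>m k) $$ (i, j)) \<le> (b * real n) ^ k"
      using bound[of k] A ij by (auto simp: norm_bound_def)
    then show "norm ((A ^\<^sub>m k) $$ (i, j) / fact k) \<le> inverse (fact k) * (b * real n) ^ k"
      by (simp add: field_simps)
  qed
qed

text \<open>The matrix with \<open>R\<close> block rows and \<open>C\<close> block columns whose block in position
  \<open>(a, b)\<close>, counted from 0, is the \<open>r\<close> by \<open>c\<close> matrix \<open>B a b\<close>.\<close>

definition block_grid :: "nat \<Rightarrow> nat \<Rightarrow> nat \<Rightarrow> nat \<Rightarrow> (nat \<Rightarrow> nat \<Rightarrow> real mat) \<Rightarrow> real mat" where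
  "block_grid R C r c B =
     mat (R * r) (C * c) (\<lambda>(i, j). B (i div r) (j div c) $$ (i mod r, j mod c))"

definition kron :: "real mat \<Rightarrow> real mat \<Rightarrow> real mat" (infixl \<open>\<otimes>\<^sub>K\<close> 75) where
  "A \<otimes>\<^sub>K B = block_grid (dim_row A) (dim_col A) (dim_row B) (dim_col B)
     (\<lambda>a b. A $$ (a, b) \<cdot>\<^sub>m B)"

definition ones :: "nat \<Rightarrow> real mat" where
  "ones n = mat n 1 (\<lambda>_. 1)"

definition unit_col :: "nat \<Rightarrow> nat \<Rightarrow> real mat" where
  "unit_col n k = mat n 1 (\<lambda>(i, _). if i = k then 1 else 0)"

section \<open>The common-shock phase-type model\<close>

definition prob_row :: "nat \<Rightarrow> real mat \<Rightarrow> bool" where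
  "prob_row p \<alpha> \<longleftrightarrow>
     \<alpha> \<in> carrier_mat 1 p \<and> (\<forall>i<p. 0 \<le> \<alpha> $$ (0, i)) \<and> (\<Sum>i<p. \<alpha> $$ (0, i)) = 1"

text \<open>Subintensity matrix all of whose states are transient. For a subintensity matrix,
  transience of all states is expressed as nonsingularity of the matrix.\<close>

definition transient_subintensity :: "nat \<Rightarrow> real mat \<Rightarrow> bool" where
  "transient_subintensity p M \<longleftrightarrow>
     M \<in> carrier_mat p p \<and>
     (\<forall>i<p. M $$ (i, i) \<le> 0) \<and>
     (\<forall>i<p. \<forall>j<p. i \<noteq> j \<longrightarrow> 0 \<le> M $$ (i, j)) \<and>
     (\<forall>i<p. (\<Sum>j<p. M $$ (i, j)) \<le> 0) \<and>
     invertible_mat M"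

text \<open>Here \<open>p\<close> is the number of pre-shock states and \<open>m\<close> the number of post-shock states;
  being numbered separately, the two state spaces are disjoint.\<close>

definition common_shock_ph ::
  "nat \<Rightarrow> nat \<Rightarrow> real mat \<Rightarrow> real mat \<Rightarrow> real mat \<Rightarrow> real mat \<Rightarrow> real mat \<Rightarrow> bool" where
  "common_shock_ph p m \<alpha> T U Q1 Q2 \<longleftrightarrow>
     0 < p \<and> 0 < m \<and>
     prob_row p \<alpha> \<and>
     transient_subintensity p T \<and>
     transient_subintensity m Q1 \<and>
     transient_subintensity m Q2 \<and>
     U \<in> carrier_mat p m \<and> (\<forall>i<p. \<forall>k<m. 0 \<le> U $$ (i, k)) \<and>
     T * ones p + U * ones m = 0\<^sub>m p 1"

definition exit_vec :: "real mat \<Rightarrow> real mat" where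
  "exit_vec Q = - (Q * ones (dim_col Q))"

text \<open>The matrix \<open>P\<close>, the sum over the post-shock states \<open>k\<close> being taken entrywise (there is
  no type-class sum on \<open>real mat\<close>, which has no type-level dimension).\<close>

definition shock_mat :: "real mat \<Rightarrow> real mat" where
  "shock_mat U = (let m = dim_col U in
     mat (dim_row U) (m * m) (\<lambda>(i, j). \<Sum>k<m.
       (U * unit_col m k * ((unit_col m k)\<^sup>T \<otimes>\<^sub>K (unit_col m k)\<^sup>T)) $$ (i, j)))"

definition joint_density ::
  "real mat \<Rightarrow> real mat \<Rightarrow> real mat \<Rightarrow> real mat \<Rightarrow> real mat \<Rightarrow> real \<Rightarrow> real \<Rightarrow> real \<Rightarrow> real" where
  "joint_density \<alpha> T U Q1 Q2 x12 x1 x2 =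
     (\<alpha> * mat_exp (x12 \<cdot>\<^sub>m T) * shock_mat U *
       ((mat_exp (x1 \<cdot>\<^sub>m Q1) * exit_vec Q1) \<otimes>\<^sub>K (mat_exp (x2 \<cdot>\<^sub>m Q2) * exit_vec Q2))) $$ (0, 0)"

section \<open>Augmented block objects\<close>

definition aug_row :: "nat \<Rightarrow> real mat \<Rightarrow> real mat" where
  "aug_row N \<alpha> = (let p = dim_col \<alpha> in
     block_grid 1 (N + 1) 1 p (\<lambda>_ b. if b = 0 then \<alpha> else 0\<^sub>m 1 p))"

definition aug_mat :: "nat \<Rightarrow> real \<Rightarrow> real mat \<Rightarrow> real mat" where
  "aug_mat N \<theta> M = (let p = dim_row M in
     block_grid (N + 1) (N + 1) p p (\<lambda>a b.
       if b = a then M - \<theta> \<cdot>\<^sub>m 1\<^sub>m p else if b = a + 1 then 1\<^sub>m p else 0\<^sub>m p p))"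

definition aug_col :: "nat \<Rightarrow> real mat \<Rightarrow> real mat" where
  "aug_col N q = (let m = dim_row q in
     block_grid (N + 1) 1 m 1 (\<lambda>a _. if a = N then q else 0\<^sub>m m 1))"

definition id_down :: "nat \<Rightarrow> nat \<Rightarrow> real mat" where
  "id_down p N = block_grid (N + 1) 1 p p (\<lambda>a _. if a = N then 1\<^sub>m p else 0\<^sub>m p p)"

definition id_left :: "nat \<Rightarrow> nat \<Rightarrow> real mat" where
  "id_left p N = block_grid 1 (N + 1) p p (\<lambda>_ b. if b = 0 then 1\<^sub>m p else 0\<^sub>m p p)"

end

theory Submission
  imports Defs
begin

text \<open>
  Write \<open>B\<close> for \<open>x \<cdot>\<^sub>m aug_mat N \<theta> M\<close> and \<open>D\<close> for its diagonal block \<open>x (M - \<theta> I)\<close>. The scalar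
  blocks \<open>x I\<close> above the diagonal commute with \<open>D\<close>. A block path of length \<open>k\<close> from block row \<open>0\<close>
  to block column \<open>b\<close> climbs exactly \<open>b\<close> times and stays put \<open>k - b\<close> times, so the block of
  \<open>B ^ k\<close> in position \<open>(0, b)\<close> is \<open>(k choose b) x ^ b D ^ (k - b)\<close> (\<open>index_pow_aug_mat\<close>). Dividing
  by \<open>k!\<close> and summing over \<open>k\<close>, the block of \<open>exp B\<close> in position \<open>(0, N)\<close> is
  \<open>x ^ N / N! \<cdot> exp D\<close>, and \<open>exp D = exp (- \<theta> x) exp (x M)\<close> since a multiple of the identity
  commutes with everything (\<open>mat_exp_add_scalar_mat\<close>). Thus the upper right corner block of the
  augmented exponential is the original exponential times \<open>x ^ N / N! \<cdot> exp (- \<theta> x)\<close>.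

  The augmented vectors only select this corner: \<open>aug_row N \<alpha> = \<alpha> * id_left p N\<close> and
  \<open>aug_col N q = id_down m N * q\<close>. Each of the three matrix factors of the density, in its
  augmented form, is therefore the original factor times a scalar. The scalars
  leave the matrix and Kronecker products by bilinearity, and the factorials cancel.
\<close>

section \<open>Matrix exponentials and scalar matrices\<close>

lemma mat_exp_carrier [simp]: "A \<in> carrier_mat n m \<Longrightarrow> mat_exp A \<in> carrier_mat n m"
  by (auto simp: mat_exp_def)

lemma mat_exp_index:
  assumes "A \<in> carrier_mat n n" "i < n" "j < n"
  shows "mat_exp A $$ (i, j) = (\<Sum>k. (A ^\<^sub>m k) $$ (i, j) / fact k)"
  using assms by (simp add: mat_exp_def)

lemma mat_exp_sums:
  assumes "A \<in> carrier_mat n n" "i < n" "j < n"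
  shows "(\<lambda>k. (A ^\<^sub>m k) $$ (i, j) / fact k) sums mat_exp A $$ (i, j)"
  using summable_mat_exp[OF assms] mat_exp_index[OF assms] by (simp add: sums_iff)

lemma index_mult_mat_sum:
  assumes "A \<in> carrier_mat r n" "B \<in> carrier_mat n c" "i < r" "j < c"
  shows "(A * B) $$ (i, j) = (\<Sum>l<n. A $$ (i, l) * B $$ (l, j))"
  using assms by (simp add: scalar_prod_def atLeast0LessThan)

lemma index_pow_mat_Suc:
  assumes "A \<in> carrier_mat n n" "i < n" "j < n"
  shows "(A ^\<^sub>m Suc k) $$ (i, j) = (\<Sum>l<n. (A ^\<^sub>m k) $$ (i, l) * A $$ (l, j))"
  using index_mult_mat_sum[OF pow_carrier_mat[OF assms(1)] assms] by simp

lemma index_smult_pow_mat: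
  fixes A :: "real mat"
  assumes A: "A \<in> carrier_mat n n" and "i < n" "j < n"
  shows "((c \<cdot>\<^sub>m A) ^\<^sub>m k) $$ (i, j) = c ^ k * (A ^\<^sub>m k) $$ (i, j)"
  using assms(2,3)
proof (induction k arbitrary: j)
  case 0
  then show ?case using A by simp
next
  case (Suc k)
  have "((c \<cdot>\<^sub>m A) ^\<^sub>m Suc k) $$ (i, j) = (\<Sum>l<n. c ^ k * (A ^\<^sub>m k) $$ (i, l) * (c * A $$ (l, j)))"
    using A Suc by (subst index_pow_mat_Suc[where n = n]) auto
  then show ?case using A Suc.prems
    by (simp add: index_pow_mat_Suc[where n = n] sum_distrib_left mult_ac del: pow_mat.simps)
qed

text \<open>Absolute convergence is what the Cauchy product needs. It comes from plain convergence for
  \<open>2 A\<close>: a real power series that converges at \<open>2\<close> converges absolutely at \<open>1\<close>.\<close>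

lemma summable_abs_mat_exp:
  fixes A :: "real mat"
  assumes A: "A \<in> carrier_mat n n" and ij: "i < n" "j < n"
  shows "summable (\<lambda>k. norm ((A ^\<^sub>m k) $$ (i, j) / fact k))"
proof -
  have "summable (\<lambda>k. ((2 \<cdot>\<^sub>m A) ^\<^sub>m k) $$ (i, j) / fact k)"
    using A ij by (intro summable_mat_exp) auto
  then have "summable (\<lambda>k. (A ^\<^sub>m k) $$ (i, j) / fact k * 2 ^ k)"
    using A ij by (simp add: index_smult_pow_mat mult_ac)
  from powser_insidea[OF this, of 1] show ?thesis by simp
qed

text \<open>The binomial theorem for \<open>A\<close> and \<open>c I\<close>, read off entry by entry so that the Cauchy product
  of real series applies to it.\<close>

lemma index_pow_add_scalar_mat:
  fixes A :: "real mat"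
  assumes A: "A \<in> carrier_mat n n" and "i < n" "j < n"
  shows "((A + c \<cdot>\<^sub>m 1\<^sub>m n) ^\<^sub>m k) $$ (i, j)
    = (\<Sum>l\<le>k. of_nat (k choose l) * (A ^\<^sub>m l) $$ (i, j) * c ^ (k - l))"
  using assms(2,3)
proof (induction k arbitrary: j)
  case 0
  then show ?case using A by simp
next
  case (Suc k)
  let ?a = "\<lambda>l. (A ^\<^sub>m l) $$ (i, j)"
  have "((A + c \<cdot>\<^sub>m 1\<^sub>m n) ^\<^sub>m Suc k) $$ (i, j)
    = (\<Sum>s<n. ((A + c \<cdot>\<^sub>m 1\<^sub>m n) ^\<^sub>m k) $$ (i, s) * (A $$ (s, j) + c * (if s = j then 1 else 0)))"
    using A Suc.prems by (subst index_pow_mat_Suc[where n = n]) auto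
  also have "\<dots> = (\<Sum>s<n. (\<Sum>l\<le>k. of_nat (k choose l) * (A ^\<^sub>m l) $$ (i, s) * c ^ (k - l)) * A $$ (s, j))
      + c * ((A + c \<cdot>\<^sub>m 1\<^sub>m n) ^\<^sub>m k) $$ (i, j)"
  proof -
    have "(\<Sum>s<n. B s * (A $$ (s, j) + c * (if s = j then 1 else 0)))
        = (\<Sum>s<n. B s * A $$ (s, j)) + c * B j" for B
    proof -
      have "(\<Sum>s<n. B s * (A $$ (s, j) + c * (if s = j then 1 else 0)))
        = (\<Sum>s<n. B s * A $$ (s, j) + (if s = j then c * B j else 0))"
        by (intro sum.cong) (auto simp: distrib_left)
      then show ?thesis using Suc.prems by (simp add: sum.distrib)
    qed
    then show ?thesis
      by (simp only:, intro arg_cong2[where f = "(+)"] sum.cong refl) (simp add: Suc.IH[OF Suc.prems(1)])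
  qed
  also have "(\<Sum>s<n. (\<Sum>l\<le>k. of_nat (k choose l) * (A ^\<^sub>m l) $$ (i, s) * c ^ (k - l)) * A $$ (s, j))
      = (\<Sum>l\<le>k. of_nat (k choose l) * ?a (Suc l) * c ^ (k - l))"
    using A Suc.prems
    by (subst index_pow_mat_Suc[where n = n])
       (auto simp: sum_distrib_left sum_distrib_right mult_ac intro: sum.swap)
  also have "c * ((A + c \<cdot>\<^sub>m 1\<^sub>m n) ^\<^sub>m k) $$ (i, j) =
      (\<Sum>l\<le>k. of_nat (k choose l) * ?a l * c ^ (Suc k - l))"
    using Suc by (simp add: sum_distrib_left Suc_diff_le mult_ac)
  also have "\<dots> = (\<Sum>l\<le>Suc k. of_nat (k choose l) * ?a l * c ^ (Suc k - l))"
    by simp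
  also have "\<dots> = ?a 0 * c ^ Suc k + (\<Sum>l\<le>k. of_nat (k choose Suc l) * ?a (Suc l) * c ^ (k - l))"
    by (subst sum.atMost_Suc_shift) (simp del: pow_mat.simps)
  also have "(\<Sum>l\<le>k. of_nat (k choose l) * ?a (Suc l) * c ^ (k - l)) + \<dots>
     = (\<Sum>l\<le>Suc k. of_nat (Suc k choose l) * ?a l * c ^ (Suc k - l))"
    by (subst sum.atMost_Suc_shift) (simp add: sum.distrib ring_distribs del: pow_mat.simps)
  finally show ?case .
qed

text \<open>By the binomial theorem above, the series for \<open>exp (A + c I)\<close> is the Cauchy product of the
  series for \<open>exp A\<close> and \<open>exp c\<close>.\<close>

lemma mat_exp_add_scalar_mat:
  fixes A :: "real mat"
  assumes A: "A \<in> carrier_mat n n"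
  shows "mat_exp (A + c \<cdot>\<^sub>m 1\<^sub>m n) = exp c \<cdot>\<^sub>m mat_exp A"
proof (rule eq_matI)
  fix i j assume "i < dim_row (exp c \<cdot>\<^sub>m mat_exp A)" "j < dim_col (exp c \<cdot>\<^sub>m mat_exp A)"
  then have ij: "i < n" "j < n" using A by (auto simp: mat_exp_def)
  have expc: "summable (\<lambda>k. norm (c ^ k / fact k))" "(\<Sum>k. c ^ k / fact k) = exp c"
    using summable_norm_exp[of c] by (simp_all add: exp_def divide_inverse mult_ac)
  have "(\<lambda>k. \<Sum>l\<le>k. (A ^\<^sub>m l) $$ (i, j) / fact l * (c ^ (k - l) / fact (k - l)))
      sums (mat_exp A $$ (i, j) * exp c)"
    using Cauchy_product_sums[OF summable_abs_mat_exp[OF A ij] expc(1)] A ij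
    by (simp add: expc(2) mat_exp_index[where n = n])
  also have "(\<lambda>k. \<Sum>l\<le>k. (A ^\<^sub>m l) $$ (i, j) / fact l * (c ^ (k - l) / fact (k - l)))
      = (\<lambda>k. ((A + c \<cdot>\<^sub>m 1\<^sub>m n) ^\<^sub>m k) $$ (i, j) / fact k)"
    unfolding index_pow_add_scalar_mat[OF A ij]
    by (auto simp: sum_divide_distrib binomial_fact fun_eq_iff intro!: sum.cong)
  finally show "mat_exp (A + c \<cdot>\<^sub>m 1\<^sub>m n) $$ (i, j) = (exp c \<cdot>\<^sub>m mat_exp A) $$ (i, j)"
    using A ij sums_unique2[OF mat_exp_sums[of "A + c \<cdot>\<^sub>m 1\<^sub>m n" n i j]]
    by (simp add: mat_exp_def mult_ac)
qed (use A in \<open>auto simp: mat_exp_def\<close>)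

section \<open>The exponential of the augmented matrix\<close>

lemma block_index_less: "e \<le> N \<Longrightarrow> s < p \<Longrightarrow> e * p + s < (N + 1) * (p::nat)"
  by (metis add.commute add_mono_thms_linordered_field(4) mult_le_mono1 distrib_right mult_1)

lemma aug_mat_carrier:
  "M \<in> carrier_mat p p \<Longrightarrow> aug_mat N \<theta> M \<in> carrier_mat ((N + 1) * p) ((N + 1) * p)"
  by (simp add: aug_mat_def Let_def block_grid_def)

lemma id_down_carrier: "id_down p N \<in> carrier_mat ((N + 1) * p) p"
  by (simp add: id_down_def block_grid_def)

lemma id_left_carrier: "id_left p N \<in> carrier_mat p ((N + 1) * p)"
  by (simp add: id_left_def block_grid_def)

lemma aug_mat_index:
  assumes M: "M \<in> carrier_mat p p" and "a \<le> N" "b \<le> N" "s < p" "j < p"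
  shows "aug_mat N \<theta> M $$ (a * p + s, b * p + j) =
    (if a = b then (M - \<theta> \<cdot>\<^sub>m 1\<^sub>m p) $$ (s, j) else if b = Suc a \<and> s = j then 1 else 0)"
  using assms block_index_less[of a N s p] block_index_less[of b N j p]
  by (auto simp: aug_mat_def block_grid_def Let_def)

lemma sum_blocks: "(\<Sum>l<(N + 1) * p. f l) = (\<Sum>e\<le>N. \<Sum>s<p. f (e * p + s))" for p :: nat
proof -
  have "(\<Sum>s<p. f (e * p + s)) = sum f {e * p..<e * p + p}" for e
    using sum.shift_bounds_nat_ivl[of f 0 "e * p" p] by (simp add: atLeast0LessThan add.commute)
  then show ?thesis
    using sum.nat_group[of f p "N + 1"] by (simp add: lessThan_Suc_atMost)
qed

text \<open>The powers satisfy Pascal's rule: a path that ends in block column \<open>b\<close> after \<open>k + 1\<close> steps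
  either was there already and multiplies by the diagonal block, or comes from block column
  \<open>b - 1\<close> and multiplies by \<open>x I\<close>. For \<open>k < b\<close> the binomial coefficient vanishes, so the
  truncated exponent \<open>k - b\<close> does no harm.\<close>

lemma index_pow_aug_mat:
  assumes M: "M \<in> carrier_mat p p" and "i < p" "b \<le> N" "j < p"
  shows "((x \<cdot>\<^sub>m aug_mat N \<theta> M) ^\<^sub>m k) $$ (i, b * p + j) =
    of_nat (k choose b) * x ^ b * ((x \<cdot>\<^sub>m (M - \<theta> \<cdot>\<^sub>m 1\<^sub>m p)) ^\<^sub>m (k - b)) $$ (i, j)"
  using assms(3,4)
proof (induction k arbitrary: b j)
  case 0
  have A: "x \<cdot>\<^sub>m aug_mat N \<theta> M \<in> carrier_mat ((N + 1) * p) ((N + 1) * p)"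
    using M by (intro smult_carrier_mat aug_mat_carrier)
  have "((x \<cdot>\<^sub>m aug_mat N \<theta> M) ^\<^sub>m 0) $$ (i, b * p + j) = (if i = b * p + j then 1 else 0)"
  proof -
    have "i < (N + 1) * p" "b * p + j < (N + 1) * p"
      using block_index_less[of 0 N i p] block_index_less[of b N j p] 0 \<open>i < p\<close> by simp_all
    then show ?thesis
      using carrier_matD[OF A] by (simp only: pow_mat.simps index_one_mat)
  qed
  then show ?case
    using M \<open>i < p\<close> 0 by (cases b) auto
next
  case (Suc k)
  define D where "D = x \<cdot>\<^sub>m (M - \<theta> \<cdot>\<^sub>m 1\<^sub>m p)"
  let ?A = "x \<cdot>\<^sub>m aug_mat N \<theta> M"
  have D: "D \<in> carrier_mat p p"
    unfolding D_def by (intro smult_carrier_mat minus_carrier_mat one_carrier_mat)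
  have A: "?A \<in> carrier_mat ((N + 1) * p) ((N + 1) * p)"
    using M by (intro smult_carrier_mat aug_mat_carrier)
  \<comment> \<open>Block column \<open>b\<close> has at most two nonzero blocks; writing the entry as a sum separates them below.\<close>
  have ent: "?A $$ (e * p + s, b * p + j) =
     (if e = b then D $$ (s, j) else 0) + (if b = Suc e \<and> s = j then x else 0)"
    if "e \<le> N" "s < p" for e s
    using that Suc.prems M block_index_less[of e N s p] block_index_less[of b N j p]
     aug_mat_carrier[OF M, of N \<theta>]
    by (auto simp: aug_mat_index D_def)
  have "(?A ^\<^sub>m Suc k) $$ (i, b * p + j)
      = (\<Sum>e\<le>N. \<Sum>s<p. (?A ^\<^sub>m k) $$ (i, e * p + s) * ?A $$ (e * p + s, b * p + j))"
  proof -
    have "i < (N + 1) * p" "b * p + j < (N + 1) * p"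
      using block_index_less[of 0 N i p] block_index_less[of b N j p] Suc.prems \<open>i < p\<close> by simp_all
    then show ?thesis by (simp only: index_pow_mat_Suc[OF A] sum_blocks)
  qed
  also have "\<dots> = (\<Sum>e\<le>N. \<Sum>s<p. of_nat (k choose e) * x ^ e * (D ^\<^sub>m (k - e)) $$ (i, s)
        * ((if e = b then D $$ (s, j) else 0) + (if b = Suc e \<and> s = j then x else 0)))"
    using Suc.IH by (intro sum.cong refl) (auto simp: ent D_def)
  also have "\<dots> = (\<Sum>e\<le>N. if e = b then \<Sum>s<p. of_nat (k choose e) * x ^ e * (D ^\<^sub>m (k - e)) $$ (i, s) * D $$ (s, j) else 0)
     + (\<Sum>e\<le>N. if b = Suc e then of_nat (k choose e) * x ^ e * (D ^\<^sub>m (k - e)) $$ (i, j) * x else 0)"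
    unfolding sum.distrib[symmetric] using Suc.prems
    by (intro sum.cong refl) (auto simp: distrib_left sum.distrib if_distrib cong: if_cong)
  also have "(\<Sum>e\<le>N. if e = b then \<Sum>s<p. of_nat (k choose e) * x ^ e * (D ^\<^sub>m (k - e)) $$ (i, s) * D $$ (s, j) else 0)
     = of_nat (k choose b) * x ^ b * (D ^\<^sub>m Suc (k - b)) $$ (i, j)"
    using Suc.prems \<open>i < p\<close>
    by (simp add: index_pow_mat_Suc[OF D] sum_distrib_left mult_ac del: pow_mat.simps)
  also have "\<dots> = of_nat (k choose b) * x ^ b * (D ^\<^sub>m (Suc k - b)) $$ (i, j)"
    by (cases "b \<le> k") (simp_all add: Suc_diff_le)
  also have "(\<Sum>e\<le>N. if b = Suc e then of_nat (k choose e) * x ^ e * (D ^\<^sub>m (k - e)) $$ (i, j) * x else 0)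
     = (if b = 0 then 0 else of_nat (k choose (b - 1)) * x ^ b * (D ^\<^sub>m (Suc k - b)) $$ (i, j))"
    using Suc.prems by (cases b) (auto simp: mult_ac)
  also have "of_nat (k choose b) * x ^ b * (D ^\<^sub>m (Suc k - b)) $$ (i, j) + \<dots>
      = of_nat (Suc k choose b) * x ^ b * (D ^\<^sub>m (Suc k - b)) $$ (i, j)"
    by (cases b) (simp_all add: algebra_simps)
  finally show ?case by (simp add: D_def)
qed

lemma index_mat_exp_aug_mat:
  assumes M: "M \<in> carrier_mat p p" and ij: "i < p" "j < p"
  shows "mat_exp (x \<cdot>\<^sub>m aug_mat N \<theta> M) $$ (i, N * p + j)
    = x ^ N / fact N * exp (- \<theta> * x) * mat_exp (x \<cdot>\<^sub>m M) $$ (i, j)"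
proof -
  let ?A = "x \<cdot>\<^sub>m aug_mat N \<theta> M"
  define D where "D = x \<cdot>\<^sub>m (M - \<theta> \<cdot>\<^sub>m 1\<^sub>m p)"
  have A: "?A \<in> carrier_mat ((N + 1) * p) ((N + 1) * p)"
    using M by (intro smult_carrier_mat aug_mat_carrier)
  have D: "D \<in> carrier_mat p p"
    unfolding D_def by (intro smult_carrier_mat minus_carrier_mat one_carrier_mat)
  have "D = x \<cdot>\<^sub>m M + (- \<theta> * x) \<cdot>\<^sub>m 1\<^sub>m p"
    using M by (intro eq_matI) (auto simp: D_def algebra_simps)
  then have expD: "mat_exp D = exp (- \<theta> * x) \<cdot>\<^sub>m mat_exp (x \<cdot>\<^sub>m M)"
    using mat_exp_add_scalar_mat[of "x \<cdot>\<^sub>m M" p] M by simp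
  \<comment> \<open>The terms with index below \<open>N\<close> vanish. Shifting by \<open>N\<close> turns \<open>(k + N choose N) / (k + N)!\<close>
    into \<open>1 / (N! k!)\<close> and leaves the series of \<open>exp D\<close>.\<close>
  have "(\<lambda>k. x ^ N / fact N * ((D ^\<^sub>m k) $$ (i, j) / fact k))
      sums (x ^ N / fact N * mat_exp D $$ (i, j))"
    by (intro sums_mult mat_exp_sums[OF D] ij)
  also have "(\<lambda>k. x ^ N / fact N * ((D ^\<^sub>m k) $$ (i, j) / fact k))
      = (\<lambda>k. (?A ^\<^sub>m (k + N)) $$ (i, N * p + j) / fact (k + N))"
    using ij by (auto simp: index_pow_aug_mat[OF M] D_def binomial_fact fun_eq_iff)
  finally have "(\<lambda>k. (?A ^\<^sub>m k) $$ (i, N * p + j) / fact k)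
      sums (x ^ N / fact N * mat_exp D $$ (i, j))"
    using ij by (subst (asm) sums_zero_iff_shift) (auto simp: index_pow_aug_mat[OF M])
  then have "mat_exp ?A $$ (i, N * p + j) = x ^ N / fact N * mat_exp D $$ (i, j)"
    using sums_unique2 mat_exp_sums[OF A, of i "N * p + j"] ij
      block_index_less[of N N j p] block_index_less[of 0 N i p] by auto
  then show ?thesis
    using mat_exp_carrier[OF smult_carrier_mat[OF M, of x]] ij by (simp add: expD)
qed

section \<open>The augmented vectors select the corner block\<close>

lemma id_left_index:
  assumes "i < p" "l < (N + 1) * p"
  shows "id_left p N $$ (i, l) = (if l = i then 1 else 0)"
  using assms by (auto simp: id_left_def block_grid_def div_eq_0_iff)

lemma id_down_index:
  assumes "j < p" "l < (N + 1) * p"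
  shows "id_down p N $$ (l, j) = (if l = N * p + j then 1 else 0)"
  using assms mod_less_divisor[of p l] div_mult_mod_eq[of l p]
  by (auto simp: id_down_def block_grid_def)

lemma aug_row_eq:
  assumes "\<alpha> \<in> carrier_mat 1 p"
  shows "aug_row N \<alpha> = \<alpha> * id_left p N"
proof (rule eq_matI)
  fix i l assume "i < dim_row (\<alpha> * id_left p N)" "l < dim_col (\<alpha> * id_left p N)"
  then have "i = 0" and l: "l < (N + 1) * p"
    using assms id_left_carrier[of p N] by auto
  have "(\<alpha> * id_left p N) $$ (0, l) = (\<Sum>s<p. \<alpha> $$ (0, s) * (if l = s then 1 else 0))"
    using assms l id_left_carrier[of p N]
    by (subst index_mult_mat_sum[OF assms id_left_carrier]) (auto simp: id_left_index)
  also have "\<dots> = (if l < p then \<alpha> $$ (0, l) else 0)"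
    by (simp add: if_distrib cong: if_cong)
  finally show "aug_row N \<alpha> $$ (i, l) = (\<alpha> * id_left p N) $$ (i, l)"
    using assms l \<open>i = 0\<close> by (auto simp: aug_row_def block_grid_def Let_def div_eq_0_iff)
qed (use assms in \<open>auto simp: aug_row_def block_grid_def Let_def id_left_def\<close>)

lemma aug_col_eq:
  assumes "q \<in> carrier_mat m 1"
  shows "aug_col N q = id_down m N * q"
proof (rule eq_matI)
  fix l j assume "l < dim_row (id_down m N * q)" "j < dim_col (id_down m N * q)"
  then have "j = 0" and l: "l < (N + 1) * m" using assms id_down_carrier[of m N] by auto
  have "m > 0" using l by (cases m) auto
  have "(id_down m N * q) $$ (l, 0) = (\<Sum>s<m. (if l = N * m + s then 1 else 0) * q $$ (s, 0))"
    using assms l id_down_carrier[of m N]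
    by (subst index_mult_mat_sum[OF id_down_carrier assms]) (auto simp: id_down_index)
  also have "\<dots> = (\<Sum>s<m. if s = l mod m then (if l div m = N then q $$ (s, 0) else 0) else 0)"
    using div_mult_mod_eq[of l m] by (intro sum.cong) auto
  finally show "aug_col N q $$ (l, j) = (id_down m N * q) $$ (l, j)"
    using assms l \<open>j = 0\<close> \<open>m > 0\<close> by (auto simp: aug_col_def block_grid_def Let_def)
qed (use assms in \<open>auto simp: aug_col_def block_grid_def Let_def id_down_def\<close>)

lemma index_corner:
  assumes E: "E \<in> carrier_mat ((N + 1) * p) ((N + 1) * p)" and ij: "i < p" "j < p"
  shows "(id_left p N * E * id_down p N) $$ (i, j) = E $$ (i, N * p + j)"
proof -
  note lt = block_index_less[of 0 N i p] block_index_less[of N N j p]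
  have 1: "(id_left p N * E) $$ (i, l) = E $$ (i, l)" if "l < (N + 1) * p" for l
  proof -
    have "(id_left p N * E) $$ (i, l) = (\<Sum>s<(N + 1) * p. (if s = i then 1 else 0) * E $$ (s, l))"
      using E ij that id_left_carrier[of p N]
      by (subst index_mult_mat_sum[OF id_left_carrier E]) (auto simp: id_left_index)
    then show ?thesis using lt ij by (simp add: if_distrib[of "\<lambda>x. x * _"] cong: if_cong)
  qed
  have "(id_left p N * E * id_down p N) $$ (i, j)
      = (\<Sum>s<(N + 1) * p. E $$ (i, s) * (if s = N * p + j then 1 else 0))"
    using E ij id_left_carrier[of p N] id_down_carrier[of p N]
    by (subst index_mult_mat_sum[OF mult_carrier_mat[OF id_left_carrier E] id_down_carrier])
       (use ij in \<open>auto simp: id_down_index 1 simp del: index_mult_mat(1) intro!: sum.cong\<close>)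
  then show ?thesis using lt ij by (simp add: if_distrib cong: if_cong)
qed

text \<open>Size biasing and Esscher tilting of a matrix exponential are the extraction of the corner
  block of the augmented one; the rest of the argument moves scalars through products.\<close>

lemma mat_exp_aug_mat_corner:
  assumes M: "M \<in> carrier_mat p p"
  shows "id_left p N * mat_exp (x \<cdot>\<^sub>m aug_mat N \<theta> M) * id_down p N
    = (x ^ N / fact N * exp (- \<theta> * x)) \<cdot>\<^sub>m mat_exp (x \<cdot>\<^sub>m M)"
proof (rule eq_matI)
  have E: "mat_exp (x \<cdot>\<^sub>m aug_mat N \<theta> M) \<in> carrier_mat ((N + 1) * p) ((N + 1) * p)"
    using M by (intro mat_exp_carrier smult_carrier_mat aug_mat_carrier)
  have X: "mat_exp (x \<cdot>\<^sub>m M) \<in> carrier_mat p p" using M by simp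
  fix i j assume "i < dim_row ((x ^ N / fact N * exp (- \<theta> * x)) \<cdot>\<^sub>m mat_exp (x \<cdot>\<^sub>m M))"
    "j < dim_col ((x ^ N / fact N * exp (- \<theta> * x)) \<cdot>\<^sub>m mat_exp (x \<cdot>\<^sub>m M))"
  then have ij: "i < p" "j < p" using X by auto
  show "(id_left p N * mat_exp (x \<cdot>\<^sub>m aug_mat N \<theta> M) * id_down p N) $$ (i, j)
    = ((x ^ N / fact N * exp (- \<theta> * x)) \<cdot>\<^sub>m mat_exp (x \<cdot>\<^sub>m M)) $$ (i, j)"
    using X ij by (simp only: index_corner[OF E ij] index_mat_exp_aug_mat[OF M ij]) simp
qed (use M in \<open>auto simp: mat_exp_def id_left_def id_down_def block_grid_def\<close>)

section \<open>The tilted density\<close>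

lemma kron_carrier [simp]:
  "A \<in> carrier_mat r c \<Longrightarrow> B \<in> carrier_mat r' c' \<Longrightarrow> A \<otimes>\<^sub>K B \<in> carrier_mat (r * r') (c * c')"
  by (auto simp: kron_def block_grid_def)

lemma kron_smult: "(a \<cdot>\<^sub>m A) \<otimes>\<^sub>K (b \<cdot>\<^sub>m B) = (a * b) \<cdot>\<^sub>m (A \<otimes>\<^sub>K B)"
proof (rule eq_matI)
  fix i j assume "i < dim_row ((a * b) \<cdot>\<^sub>m (A \<otimes>\<^sub>K B))" "j < dim_col ((a * b) \<cdot>\<^sub>m (A \<otimes>\<^sub>K B))"
  then have i: "i < dim_row A * dim_row B" and j: "j < dim_col A * dim_col B"
    by (simp_all add: kron_def block_grid_def)
  then have "0 < dim_row B" "0 < dim_col B" by (auto intro!: Nat.gr0I)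
  with i j show "((a \<cdot>\<^sub>m A) \<otimes>\<^sub>K (b \<cdot>\<^sub>m B)) $$ (i, j) = ((a * b) \<cdot>\<^sub>m (A \<otimes>\<^sub>K B)) $$ (i, j)"
    by (simp add: kron_def block_grid_def less_mult_imp_div_less)
qed (simp_all add: kron_def block_grid_def)

lemma aug_row_mat_exp:
  assumes \<alpha>: "\<alpha> \<in> carrier_mat 1 p" and T: "T \<in> carrier_mat p p"
  shows "aug_row N \<alpha> * mat_exp (x \<cdot>\<^sub>m aug_mat N \<theta> T) * id_down p N
    = (x ^ N / fact N * exp (- \<theta> * x)) \<cdot>\<^sub>m (\<alpha> * mat_exp (x \<cdot>\<^sub>m T))"
proof -
  let ?E = "mat_exp (x \<cdot>\<^sub>m aug_mat N \<theta> T)"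
  have E: "?E \<in> carrier_mat ((N + 1) * p) ((N + 1) * p)"
    using T by (intro mat_exp_carrier smult_carrier_mat aug_mat_carrier)
  have "aug_row N \<alpha> * ?E * id_down p N = \<alpha> * (id_left p N * ?E * id_down p N)"
    unfolding aug_row_eq[OF \<alpha>]
    using assoc_mult_mat[OF \<alpha> id_left_carrier E]
      assoc_mult_mat[OF \<alpha> mult_carrier_mat[OF id_left_carrier E] id_down_carrier] by simp
  also have "\<dots> = (x ^ N / fact N * exp (- \<theta> * x)) \<cdot>\<^sub>m (\<alpha> * mat_exp (x \<cdot>\<^sub>m T))"
    using T mult_smult_distrib[OF \<alpha>, of "mat_exp (x \<cdot>\<^sub>m T)" p]
    by (simp add: mat_exp_aug_mat_corner)
  finally show ?thesis .
qed

lemma mat_exp_aug_col: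
  assumes Q: "Q \<in> carrier_mat m m" and q: "q \<in> carrier_mat m 1"
  shows "id_left m N * mat_exp (x \<cdot>\<^sub>m aug_mat N \<theta> Q) * aug_col N q
    = (x ^ N / fact N * exp (- \<theta> * x)) \<cdot>\<^sub>m (mat_exp (x \<cdot>\<^sub>m Q) * q)"
proof -
  let ?E = "mat_exp (x \<cdot>\<^sub>m aug_mat N \<theta> Q)"
  have E: "?E \<in> carrier_mat ((N + 1) * m) ((N + 1) * m)"
    using Q by (intro mat_exp_carrier smult_carrier_mat aug_mat_carrier)
  have "id_left m N * ?E * aug_col N q = id_left m N * ?E * id_down m N * q"
    unfolding aug_col_eq[OF q]
    using assoc_mult_mat[OF mult_carrier_mat[OF id_left_carrier E] id_down_carrier q] by simp
  also have "\<dots> = (x ^ N / fact N * exp (- \<theta> * x)) \<cdot>\<^sub>m (mat_exp (x \<cdot>\<^sub>m Q) * q)"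
    using Q mult_smult_assoc_mat[OF _ q, of "mat_exp (x \<cdot>\<^sub>m Q)" m]
    by (simp add: mat_exp_aug_mat_corner)
  finally show ?thesis .
qed

theorem theorem5p3:
  fixes p m :: nat
    and \<alpha> T U Q1 Q2 :: "real mat"
    and n12 n1 n2 :: nat
    and \<theta>12 \<theta>1 \<theta>2 x12 x1 x2 :: real
  assumes "common_shock_ph p m \<alpha> T U Q1 Q2"
    and "0 \<le> x12" and "0 \<le> x1" and "0 \<le> x2"
  shows "x12 ^ n12 * x1 ^ n1 * x2 ^ n2 * exp (- \<theta>12 * x12 - \<theta>1 * x1 - \<theta>2 * x2)
           * joint_density \<alpha> T U Q1 Q2 x12 x1 x2 =
         (fact n12 * fact n1 * fact n2) *
         (aug_row n12 \<alpha> * mat_exp (x12 \<cdot>\<^sub>m aug_mat n12 \<theta>12 T) * id_down p n12 * shock_mat U *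
           ((id_left m n1 * mat_exp (x1 \<cdot>\<^sub>m aug_mat n1 \<theta>1 Q1) * aug_col n1 (exit_vec Q1)) \<otimes>\<^sub>K
            (id_left m n2 * mat_exp (x2 \<cdot>\<^sub>m aug_mat n2 \<theta>2 Q2) * aug_col n2 (exit_vec Q2)))) $$ (0, 0)"
proof -
  have \<alpha>: "\<alpha> \<in> carrier_mat 1 p" and T: "T \<in> carrier_mat p p" and U: "U \<in> carrier_mat p m"
    and Q1: "Q1 \<in> carrier_mat m m" and Q2: "Q2 \<in> carrier_mat m m"
    using assms(1) by (auto simp: common_shock_ph_def prob_row_def transient_subintensity_def)
  have q: "exit_vec Q \<in> carrier_mat m 1" if "Q \<in> carrier_mat m m" for Q
    using that by (auto simp: exit_vec_def ones_def)
  define L where "L = \<alpha> * mat_exp (x12 \<cdot>\<^sub>m T)"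
  define K where "K = (mat_exp (x1 \<cdot>\<^sub>m Q1) * exit_vec Q1) \<otimes>\<^sub>K (mat_exp (x2 \<cdot>\<^sub>m Q2) * exit_vec Q2)"
  have L: "L \<in> carrier_mat 1 p"
    using \<alpha> T by (auto simp: L_def intro!: mult_carrier_mat)
  have P: "shock_mat U \<in> carrier_mat p (m * m)"
    using U by (auto simp: shock_mat_def Let_def)
  have "mat_exp (x \<cdot>\<^sub>m Q) * exit_vec Q \<in> carrier_mat m 1" if "Q \<in> carrier_mat m m" for x Q
    using q[OF that] that by (intro mult_carrier_mat) auto
  from kron_carrier[OF this[OF Q1] this[OF Q2]] have K: "K \<in> carrier_mat (m * m) 1"
    by (simp add: K_def)
  have scale: "(a \<cdot>\<^sub>m L * shock_mat U * (b \<cdot>\<^sub>m K)) $$ (0, 0) = a * b * (L * shock_mat U * K) $$ (0, 0)"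
    for a b :: real
  proof -
    have "a \<cdot>\<^sub>m L * shock_mat U * (b \<cdot>\<^sub>m K) = b \<cdot>\<^sub>m (a \<cdot>\<^sub>m (L * shock_mat U * K))"
      using mult_smult_assoc_mat[OF L P] mult_smult_assoc_mat[OF mult_carrier_mat[OF L P] K]
        mult_smult_distrib[OF smult_carrier_mat[OF mult_carrier_mat[OF L P]] K] by simp
    then show ?thesis using L K by simp
  qed
  have exps: "exp (- \<theta>12 * x12 - \<theta>1 * x1 - \<theta>2 * x2)
      = exp (- \<theta>12 * x12) * exp (- \<theta>1 * x1) * exp (- \<theta>2 * x2)"
    by (simp flip: exp_add)
  show ?thesis
    unfolding aug_row_mat_exp[OF \<alpha> T] mat_exp_aug_col[OF Q1 q[OF Q1]]
      mat_exp_aug_col[OF Q2 q[OF Q2]] kron_smult joint_density_def exps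
      L_def[symmetric] K_def[symmetric] scale
    by simp
qed

end
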